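(* Let $P(x)$ be a polynomial with real coefficients. The sequence $(\lfloor P(k)\rfloor)_{k\geq 1}$ is u.d. in $\mathbb{Z}$ if and only if $P(x)$ has an irrational coefficient other than the constant term or $P(x)=x/l+P(0)$ for some nonzero integer $l$.
   Context: An integer sequence $(a_k)_{k\geq 1}$ is u.d. (uniformly distributed) mod an integer $m\geq 2$ if for every integer $i$, $\lim_{N\to\infty}\frac{1}{N}\#\{k\in\{1,\ldots,N\}: a_k\equiv i \pmod m\}=\frac{1}{m}$. It is u.d. in $\mathbb{Z}$ if it is u.d. mod $m$ for all integers $m\geq 2$. Here $\lfloor r\rfloor$ denotes the greatest integer not exceeding $r$. *)

theory Defs
  imports
    "HOL-Analysis.Analysis"
    "HOL-Computational_Algebra.Polynomial"
    "HOL-Number_Theory.Cong"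
begin

(* Sequences (a_k) with k >= 1 are functions on nat; the value at 0 is never used.
   The notion is meant for moduli m >= 2. *)

definition ud_mod :: "(nat \<Rightarrow> int) \<Rightarrow> int \<Rightarrow> bool" where
  "ud_mod a m \<longleftrightarrow>
     (\<forall>i::int. (\<lambda>N::nat. real (card {k \<in> {1..N}. [a k = i] (mod m)}) / real N)
        \<longlonglongrightarrow> 1 / real_of_int m)"

definition ud_in_Z :: "(nat \<Rightarrow> int) \<Rightarrow> bool" where
  "ud_in_Z a \<longleftrightarrow> (\<forall>m\<ge>2. ud_mod a m)"

end

theory Submission
  imports Defs
begin

text \<open>
  Suppose first that \<open>P\<close> has an irrational coefficient besides the constant one. The residue of
  \<open>\<lfloor>P(k)\<rfloor>\<close> modulo \<open>m\<close> records in which of the \<open>m\<close> arcs \<open>[i/m, (i+1)/m)\<close> of the circle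
  \<open>\<real>/\<int>\<close> the point \<open>P(k)/m\<close> lies, so it suffices that these points are equidistributed modulo 1.
  Weyl's argument gives this in two steps. The exponential sums of \<open>(h/m) P\<close> have mean zero
  (\<open>weyl_exponential_sum\<close>): by van der Corput's theorem \<open>P\<close> may be replaced by its
  differences \<open>P(x+h) - P(x)\<close>, and these move the highest irrational coefficient down by one degree
  until it is the linear one; then a shift by a period of the rational part multiplies the terms by
  a constant different from 1. Vanishing exponential means bound the frequency of each
  arc from above, because the arc has a majorant that is a sum of translated Fejer kernels
  (\<open>weyl_criterion_ud_mod\<close>). The frequencies of the \<open>m\<close> arcs add up to 1, so upper bounds
  \<open>1/m\<close> for all of them already force equality.

  If \<open>P(x) = x/l + c\<close>, then moving \<open>k\<close> by \<open>\<bar>l\<bar>\<close> moves the floor by \<open>\<plusminus>1\<close>, so among any \<open>m\<close> steps of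
  length \<open>\<bar>l\<bar>\<close> each residue modulo \<open>m\<close> occurs exactly once.

  Suppose finally that all coefficients of \<open>P\<close> other than the constant one are rational, with a
  common denominator \<open>q\<close>, say \<open>P = c + R/q\<close> with \<open>R\<close> in \<open>\<int>[x]\<close>.
  If the degree is at least 2, then \<open>R'\<close> is not constant and
  \<open>D = R'(k\<^sub>0)\<close> exceeds \<open>q\<close> in absolute value for some \<open>k\<^sub>0\<close>. Taylor expansion shows that
  \<open>P(k\<^sub>0 + qDt) - P(k\<^sub>0)\<close> is a multiple of \<open>D\<^sup>2\<close> for every integer \<open>t\<close>. So modulo \<open>D\<^sup>2\<close> one residue
  class has frequency at least \<open>1/(q\<bar>D\<bar>)\<close>, which is more than \<open>1/D\<^sup>2\<close>.
  If the degree is at most 1, let the slope be \<open>a/b\<close> in lowest terms. For any divisor \<open>m\<close> of \<open>a\<close> the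
  floors have period \<open>b\<close> modulo \<open>m\<close>, so uniform distribution modulo \<open>m\<close> would require
  \<open>m\<close> to divide \<open>b\<close>. Hence \<open>a = \<plusminus>1\<close>.
\<close>
section \<open>Averages of sequences\<close>

definition cesaro :: "(nat \<Rightarrow> 'a::real_normed_vector) \<Rightarrow> nat \<Rightarrow> 'a" where
  "cesaro f N = (\<Sum>k=1..N. f k) /\<^sub>R real N"

lemma cesaro_add: "cesaro (\<lambda>k. f k + g k) N = cesaro f N + cesaro g N"
  by (simp add: cesaro_def sum.distrib scaleR_add_right)

lemma cesaro_diff: "cesaro (\<lambda>k. f k - g k) N = cesaro f N - cesaro g N"
  by (simp add: cesaro_def sum_subtractf scaleR_diff_right)

lemma cesaro_sum: "cesaro (\<lambda>k. \<Sum>i\<in>I. f i k) N = (\<Sum>i\<in>I. cesaro (f i) N)"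
proof -
  have "(\<Sum>k=1..N. \<Sum>i\<in>I. f i k) = (\<Sum>i\<in>I. \<Sum>k=1..N. f i k)"
    by (rule sum.swap)
  then show ?thesis
    by (simp add: cesaro_def scaleR_sum_right)
qed

lemma cesaro_cmult:
  fixes f :: "nat \<Rightarrow> 'a::real_normed_algebra"
  shows "cesaro (\<lambda>k. c * f k) N = c * cesaro f N"
  by (simp add: cesaro_def sum_distrib_left)

lemma cesaro_const: "N \<ge> 1 \<Longrightarrow> cesaro (\<lambda>k. c) N = c"
  by (simp add: cesaro_def sum_constant_scaleR)

lemma cesaro_of_real:
  "cesaro (\<lambda>k. of_real (f k) :: 'a::{real_normed_algebra_1}) N = of_real (cesaro f N)"
  by (simp add: cesaro_def scaleR_conv_of_real)

lemma cesaro_mono: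
  fixes f g :: "nat \<Rightarrow> real"
  assumes "\<And>k. f k \<le> g k"
  shows "cesaro f N \<le> cesaro g N"
  unfolding cesaro_def using assms by (simp add: sum_mono mult_left_mono)

lemma norm_cesaro_le: "norm (cesaro f N) \<le> cesaro (\<lambda>k. norm (f k)) N"
  by (simp add: cesaro_def norm_sum divide_right_mono mult_left_mono)

lemma tendsto_cesaro_const: "cesaro (\<lambda>k. c) \<longlonglongrightarrow> c"
  by (rule tendsto_eventually) (auto simp: eventually_sequentially cesaro_const intro: exI[of _ 1])

text \<open>One step of the shift changes the sum only by two boundary terms, which the division by \<open>N\<close>
  makes negligible.\<close>
lemma cesaro_shift:
  fixes f :: "nat \<Rightarrow> 'a::real_normed_vector"
  assumes bounded: "\<And>k. norm (f k) \<le> B"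
  shows "(\<lambda>N. cesaro (\<lambda>k. f (k + h)) N - cesaro f N) \<longlonglongrightarrow> 0"
proof (induction h)
  case (Suc h)
  have step: "norm (cesaro (\<lambda>k. f (k + Suc h)) N - cesaro (\<lambda>k. f (k + h)) N) \<le> 2 * B / real N"
    for N
  proof -
    have "(\<Sum>k=1..N. f (k + Suc h) - f (k + h)) = f (N + 1 + h) - f (1 + h)"
      by (induction N) auto
    then have "cesaro (\<lambda>k. f (k + Suc h)) N - cesaro (\<lambda>k. f (k + h)) N
        = (f (N + 1 + h) - f (1 + h)) /\<^sub>R real N"
      by (simp only: cesaro_diff[symmetric]) (simp only: cesaro_def)
    moreover have "norm (f (N + 1 + h) - f (1 + h)) \<le> 2 * B"
      using norm_triangle_ineq4[of "f (N + 1 + h)" "f (1 + h)"]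
        bounded[of "N + 1 + h"] bounded[of "1 + h"] by linarith
    ultimately show ?thesis
      by (simp add: divide_inverse_commute) (intro mult_left_mono, simp_all)
  qed
  have "(\<lambda>N. 2 * B / real N) \<longlonglongrightarrow> 0"
    by (rule lim_const_over_n)
  then have "(\<lambda>N. cesaro (\<lambda>k. f (k + Suc h)) N - cesaro (\<lambda>k. f (k + h)) N) \<longlonglongrightarrow> 0"
    by (rule Lim_null_comparison[OF always_eventually, rotated]) (use step in blast)
  from tendsto_add[OF this Suc.IH] show ?case
    by simp
qed simp

text \<open>The form in which shift invariance is used: whatever is known about the sums of \<open>f\<close> over
  short windows, for all positions \<open>k\<close> of the window, passes to the mean of \<open>f\<close>.\<close>
lemma cesaro_window:
  fixes f :: "nat \<Rightarrow> 'a::real_normed_vector"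
  assumes bounded: "\<And>k. norm (f k) \<le> B"
  shows "(\<lambda>N. cesaro (\<lambda>k. \<Sum>h<H. f (k + s * h)) N - real H *\<^sub>R cesaro f N) \<longlonglongrightarrow> 0"
proof -
  have "(\<lambda>N. \<Sum>h<H. cesaro (\<lambda>k. f (k + s * h)) N - cesaro f N) \<longlonglongrightarrow> (\<Sum>h<H. 0)"
    by (intro tendsto_sum cesaro_shift[OF bounded])
  then show ?thesis
    by (simp add: cesaro_sum sum_subtractf scaleR_conv_of_real sum_constant_scaleR)
qed

section \<open>The additive character of the reals modulo one\<close>

definition e :: "real \<Rightarrow> complex" where "e x = cis (2 * pi * x)"

lemma norm_e [simp]: "norm (e x) = 1"
  by (simp add: e_def)

lemma e_0 [simp]: "e 0 = 1"
  by (simp add: e_def)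

lemma e_add: "e (x + y) = e x * e y"
  by (simp add: e_def cis_mult distrib_left)

lemma cnj_e: "cnj (e x) = e (- x)"
  by (simp add: e_def cis_cnj)

lemma e_diff: "e (x - y) = e x * cnj (e y)"
  by (simp add: cnj_e flip: e_add)

lemma e_Ints [simp]: "x \<in> \<int> \<Longrightarrow> e x = 1"
  by (simp add: e_def)

lemma e_power: "e x ^ n = e (real n * x)"
  by (simp add: e_def Complex.DeMoivre mult_ac)

lemma norm_e_minus_1: "norm (e x - 1) = 2 * \<bar>sin (pi * x)\<bar>"
  using dist_exp_i_1[of "2 * pi * x"] by (simp add: e_def cis_conv_exp)

lemma e_eq_1_iff: "e x = 1 \<longleftrightarrow> x \<in> \<int>"
proof
  assume "e x = 1"
  then have "sin (pi * x) = 0"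
    using norm_e_minus_1[of x] by simp
  then obtain i :: int where "pi * x = of_int i * pi"
    by (auto simp: sin_zero_iff_int2)
  then have "x = of_int i"
    by simp
  then show "x \<in> \<int>" by simp
qed simp

text \<open>Jordan's inequality, from the concavity of the sine.\<close>
lemma sin_pi_ge:
  assumes "0 \<le> y" "y \<le> 1/2"
  shows "2 * y \<le> sin (pi * y)"
proof -
  have convex: "convex_on {0..pi/2} (\<lambda>x. - sin x)"
  proof (rule f''_ge0_imp_convex)
    show "((\<lambda>x. - sin x) has_real_derivative - cos x) (at x)" for x :: real
      by (auto intro!: derivative_eq_intros)
    show "((\<lambda>x. - cos x) has_real_derivative sin x) (at x)" for x :: real
      by (auto intro!: derivative_eq_intros)
    show "0 \<le> sin x" if "x \<in> {0..pi/2}" for x :: real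
      using that by (intro sin_ge_zero) auto
  qed auto
  show ?thesis
    using convex_onD[OF convex, of "2 * y" 0 "pi/2"] assms by (simp add: mult.commute)
qed

text \<open>A quantitative form of \<open>e y \<noteq> 1\<close> for \<open>y\<close> away from the integers; it controls the tails of the
  Fejer kernel.\<close>
lemma norm_e_minus_1_ge:
  assumes "0 \<le> \<delta>" "\<delta> \<le> y" "y \<le> 1 - \<delta>"
  shows "4 * \<delta> \<le> norm (e y - 1)"
proof -
  have *: "2 * \<delta> \<le> sin (pi * y)"
  proof (cases "y \<le> 1/2")
    case True
    then show ?thesis using sin_pi_ge[of y] assms by linarith
  next
    case False
    have "2 * \<delta> \<le> 2 * (1 - y)"
      using assms by simp
    also have "\<dots> \<le> sin (pi * (1 - y))"
      using False assms by (intro sin_pi_ge) auto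
    also have "\<dots> = sin (pi * y)"
      by (simp add: right_diff_distrib)
    finally show ?thesis .
  qed
  then show ?thesis by (simp add: norm_e_minus_1)
qed

section \<open>Van der Corput's difference theorem\<close>

lemma norm_cesaro_squared_le:
  fixes v :: "nat \<Rightarrow> complex"
  shows "(norm (cesaro v N))\<^sup>2 \<le> cesaro (\<lambda>k. (norm (v k))\<^sup>2) N"
proof (cases "N = 0")
  case False
  have "(norm (cesaro v N))\<^sup>2 \<le> (cesaro (\<lambda>k. norm (v k)) N)\<^sup>2"
    by (intro power_mono norm_cesaro_le) auto
  also have "\<dots> \<le> cesaro (\<lambda>k. (norm (v k))\<^sup>2) N"
  proof -
    have "(\<Sum>k=1..N. norm (v k))\<^sup>2 \<le> (\<Sum>k=1..N. (norm (v k))\<^sup>2) * card {1..N}"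
      by (rule sum_squared_le_sum_of_squares)
    then show ?thesis
      using False by (simp add: cesaro_def power2_eq_square field_simps)
  qed
  finally show ?thesis .
qed (simp add: cesaro_def)

text \<open>The mean of \<open>u\<close> is asymptotically \<open>1/H\<close> times that of the window sums \<open>v k\<close> of length \<open>H\<close>. By
  Cauchy-Schwarz the squared norm of the latter mean is at most the mean of \<open>\<bar>v k\<bar>\<^sup>2\<close>. When this square is
  multiplied out, the off-diagonal terms are correlations of \<open>u\<close>, which vanish in the limit, and
  the diagonal ones contribute at most \<open>H\<close>. So the mean of \<open>u\<close> is eventually of size at most about
  \<open>1/\<surd>H\<close>, where \<open>H\<close> is arbitrary.\<close>
theorem van_der_corput:
  fixes u :: "nat \<Rightarrow> complex"
  assumes bounded: "\<And>k. norm (u k) \<le> 1"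
    and corr: "\<And>h. h \<ge> 1 \<Longrightarrow> cesaro (\<lambda>k. u (k + h) * cnj (u k)) \<longlonglongrightarrow> 0"
  shows "cesaro u \<longlonglongrightarrow> 0"
proof (rule tendstoI)
  fix \<epsilon> :: real assume "\<epsilon> > 0"
  \<comment> \<open>The final estimate needs \<open>H + 1 < (H \<epsilon> / 2)\<^sup>2\<close>; for \<open>H \<ge> 1\<close> this follows from \<open>H > 8 / \<epsilon>\<^sup>2\<close>.\<close>
  define H where "H = nat \<lceil>8 / \<epsilon>\<^sup>2\<rceil> + 1"
  have H: "H \<ge> 1" "8 / \<epsilon>\<^sup>2 < real H"
    unfolding H_def by linarith+
  define v where "v k = (\<Sum>h<H. u (k + h))" for k
  define c where "c a b N = cesaro (\<lambda>k. u (k + a) * cnj (u (k + b))) N" for a b N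
  have c_less: "c a b \<longlonglongrightarrow> 0" if "b < a" for a b
  proof -
    have "(\<lambda>N. c a b N - cesaro (\<lambda>k. u (k + (a - b)) * cnj (u k)) N) \<longlonglongrightarrow> 0"
      unfolding c_def
      using cesaro_shift[of "\<lambda>k. u (k + (a - b)) * cnj (u k)" 1 b] that
      by (simp add: norm_mult mult_le_one bounded add.assoc)
    from tendsto_add[OF this corr[of "a - b"]] show ?thesis
      using that by simp
  qed
  have c_sym: "c a b N = cnj (c b a N)" for a b N
    by (simp add: c_def cesaro_def mult.commute)
  have c_neq: "c a b \<longlonglongrightarrow> 0" if "a \<noteq> b" for a b
  proof (cases "b < a")
    case False
    then have "(\<lambda>N. cnj (c b a N)) \<longlonglongrightarrow> cnj 0"
      using that by (intro tendsto_cnj c_less) auto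
    then show ?thesis by (simp flip: c_sym)
  qed (rule c_less)
  have norm_v: "complex_of_real ((norm (v k))\<^sup>2) = (\<Sum>a<H. \<Sum>b<H. u (k + a) * cnj (u (k + b)))"
    for k
    unfolding complex_norm_square v_def by (simp add: sum_product)
  have "of_real (cesaro (\<lambda>k. (norm (v k))\<^sup>2) N) = (\<Sum>a<H. \<Sum>b<H. c a b N)" for N
    unfolding cesaro_of_real[symmetric] norm_v c_def cesaro_sum ..
  moreover have "(\<Sum>a<H. \<Sum>b<H. c a b N) =
      (\<Sum>a<H. c a a N) + (\<Sum>a<H. \<Sum>b\<in>{..<H} - {a}. c a b N)" for N
    by (simp add: sum.distrib[symmetric] sum.remove[of "{..<H}"])
  ultimately have split: "of_real (cesaro (\<lambda>k. (norm (v k))\<^sup>2) N) =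
      (\<Sum>a<H. c a a N) + (\<Sum>a<H. \<Sum>b\<in>{..<H} - {a}. c a b N)" for N
    by simp
  have diag: "norm (\<Sum>a<H. c a a N) \<le> real H" for N
  proof -
    have "norm (c a a N) \<le> 1" for a
    proof -
      have "norm (c a a N) \<le> cesaro (\<lambda>k. norm (u (k + a) * cnj (u (k + a)))) N"
        unfolding c_def by (rule norm_cesaro_le)
      also have "\<dots> \<le> cesaro (\<lambda>k. 1) N"
        by (rule cesaro_mono) (simp add: norm_mult mult_le_one bounded)
      also have "\<dots> \<le> 1"
        by (cases "N = 0") (simp_all add: cesaro_def)
      finally show ?thesis .
    qed
    then show ?thesis
      using sum_norm_bound[of "{..<H}" "\<lambda>a. c a a N" 1] by simp
  qed
  have off: "(\<lambda>N. \<Sum>a<H. \<Sum>b\<in>{..<H} - {a}. c a b N) \<longlonglongrightarrow> 0"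
    by (intro tendsto_null_sum c_neq) auto
  have window: "(\<lambda>N. cesaro v N - real H *\<^sub>R cesaro u N) \<longlonglongrightarrow> 0"
    unfolding v_def using cesaro_window[OF bounded, where s = 1] by simp
  have "\<forall>\<^sub>F N in sequentially. norm (\<Sum>a<H. \<Sum>b\<in>{..<H} - {a}. c a b N) < 1"
    using tendstoD[OF off, of 1] by simp
  moreover have "\<forall>\<^sub>F N in sequentially. norm (cesaro v N - real H *\<^sub>R cesaro u N) < \<epsilon> / 2"
    using tendstoD[OF window, of "\<epsilon> / 2"] \<open>\<epsilon> > 0\<close> by simp
  ultimately show "\<forall>\<^sub>F N in sequentially. dist (cesaro u N) 0 < \<epsilon>"
  proof eventually_elim
    case (elim N)
    have "norm (complex_of_real (cesaro (\<lambda>k. (norm (v k))\<^sup>2) N)) \<le> real H + 1"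
      unfolding split using elim(1) diag[of N] norm_triangle_ineq
      by (smt (verit, best))
    then have "(norm (cesaro v N))\<^sup>2 \<le> real H + 1"
      using norm_cesaro_squared_le[of v N] by simp
    also have "\<dots> \<le> 2 * real H"
      using H by simp
    also have "\<dots> < (real H * (\<epsilon> / 2))\<^sup>2"
    proof -
      have "8 < real H * \<epsilon>\<^sup>2"
        using H \<open>\<epsilon> > 0\<close> by (simp add: field_simps)
      then have "real H * 8 < real H * (real H * \<epsilon>\<^sup>2)"
        using H by (intro mult_strict_left_mono) auto
      then show ?thesis
        by (simp add: power2_eq_square algebra_simps)
    qed
    finally have 1: "norm (cesaro v N) < real H * (\<epsilon> / 2)"
      using H \<open>\<epsilon> > 0\<close> by (intro power2_less_imp_less[of "norm (cesaro v N)"]) auto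
    have "real H * norm (cesaro u N) = norm (real H *\<^sub>R cesaro u N)"
      by simp
    also have "\<dots> \<le> norm (cesaro v N) + norm (cesaro v N - real H *\<^sub>R cesaro u N)"
      by (metis add_diff_cancel_left' diff_add_cancel norm_triangle_ineq4)
    also have "\<dots> < real H * (\<epsilon> / 2) + \<epsilon> / 2"
      using 1 elim(2) by linarith
    also have "\<dots> \<le> real H * \<epsilon>"
    proof -
      have "1 * (\<epsilon> / 2) \<le> real H * (\<epsilon> / 2)"
        using H \<open>\<epsilon> > 0\<close> by (intro mult_right_mono) auto
      then show ?thesis by simp
    qed
    finally show ?case
      using H by simp
  qed
qed

section \<open>Weyl's theorem on polynomial exponential sums\<close>

lemma clear_denominators:
  fixes g :: "real poly"
  assumes "\<And>i. coeff g i \<in> \<rat>"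
  shows "\<exists>q>0. \<exists>R::int poly. smult (real q) g = map_poly of_int R"
  using assms
proof (induction g)
  case 0
  show ?case by (intro exI[of _ 1] conjI exI[of _ 0]) auto
next
  case (pCons a g)
  have "coeff g i \<in> \<rat>" for i
    using pCons.prems[of "Suc i"] by simp
  then obtain q R where q: "q > 0" and R: "smult (real q) g = map_poly of_int (R::int poly)"
    using pCons.IH by blast
  obtain b :: int and c where c: "c > 0" and a: "a = of_int b / of_int c"
    using pCons.prems[of 0] by (auto elim: Rats_cases')
  have "smult (real (q * nat c)) (pCons a g) =
      map_poly of_int (pCons (int q * b) (smult c R))"
  proof (rule poly_eqI)
    fix i
    have "real q * coeff g n = of_int (coeff R n)" for n
      using arg_cong[OF R, of "\<lambda>p. coeff p n"] by (simp add: coeff_map_poly)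
    then show "coeff (smult (real (q * nat c)) (pCons a g)) i =
        coeff (map_poly of_int (pCons (int q * b) (smult c R))) i"
      using c by (cases i) (simp_all add: coeff_map_poly a coeff_pCons mult_ac)
  qed
  moreover have "q * nat c > 0"
    using q c by simp
  ultimately show ?case by blast
qed

lemma poly_map_of_int: "poly (map_poly of_int p) (of_int x) = (of_int (poly p x) :: real)"
  by (induction p) (simp_all add: map_poly_pCons)

text \<open>The remainder is again a value in the ring, without the denominator 2 of the usual
  second-order term; over \<open>\<int>\<close> this gives divisibility by \<open>h\<^sup>2\<close>.\<close>
lemma poly_Taylor_square_remainder:
  fixes p :: "'a::idom poly"
  shows "\<exists>w. poly p (x + h) = poly p x + h * poly (pderiv p) x + h\<^sup>2 * w"
proof (induction p)
  case (pCons a p)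
  then obtain w where w: "poly p (x + h) = poly p x + h * poly (pderiv p) x + h\<^sup>2 * w"
    by blast
  have "poly (pCons a p) (x + h) = a + (x + h) * poly p (x + h)"
    by simp
  also have "\<dots> = poly (pCons a p) x + h * poly (pderiv (pCons a p)) x
      + h\<^sup>2 * (x * w + poly (pderiv p) x + h * w)"
    by (simp only: w) (simp add: pderiv_pCons algebra_simps power2_eq_square)
  finally
  show ?case
    by (rule exI)
qed simp

lemma rational_poly_periodic_mod_1:
  fixes g :: "real poly"
  assumes "\<And>i. coeff g i \<in> \<rat>"
  shows "\<exists>q>0. \<forall>k. poly g (real (k + q)) - poly g (real k) \<in> \<int>"
proof -
  obtain q R where q: "q > 0" and R: "smult (real q) g = map_poly of_int (R::int poly)"
    using clear_denominators[OF assms] by blast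
  have eq: "real q * poly g (real k) = of_int (poly R (int k))" for k
    using arg_cong[OF R, of "\<lambda>p. poly p (real k)"] poly_map_of_int[of R "int k"] by simp
  have "poly g (real (k + q)) - poly g (real k) \<in> \<int>" for k
  proof -
    obtain w where w: "poly R (int k + int q) =
        poly R (int k) + int q * poly (pderiv R) (int k) + (int q)\<^sup>2 * w"
      using poly_Taylor_square_remainder by blast
    define d where "d = poly (pderiv R) (int k) + int q * w"
    have "poly R (int (k + q)) = poly R (int k) + int q * d"
      by (simp add: w d_def power2_eq_square distrib_left mult.assoc)
    then have "real q * poly g (real (k + q)) = real q * (poly g (real k) + of_int d)"
      by (simp add: eq distrib_left del: of_nat_add)
    then have "poly g (real (k + q)) - poly g (real k) = of_int d"
      using q by simp
    then show ?thesis by simp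
  qed
  then show ?thesis using q by blast
qed

text \<open>Modulo the rational numbers, \<open>f\<close> looks like a polynomial of degree \<open>j\<close>, and the three
  claims are the familiar facts about the top two coefficients of a translate: its degree and leading
  coefficient are unchanged, and the next coefficient grows by \<open>j h\<close> times the leading one. Hence,
  for \<open>h \<noteq> 0\<close>, passing to the difference \<open>F - f\<close> lowers the index of the highest irrational coefficient by
  exactly one.\<close>
lemma translate_coeffs_mod_Rats:
  fixes f :: "real poly"
  assumes h: "h \<in> \<rat>" and "\<And>i. i > j \<Longrightarrow> coeff f i \<in> \<rat>"
  defines "F \<equiv> pcompose f [:h, 1:]"
  shows "i > j \<Longrightarrow> coeff F i \<in> \<rat>"
    and "coeff F j - coeff f j \<in> \<rat>"
    and "j = Suc n \<Longrightarrow> coeff F n - coeff f n - real j * h * coeff f j \<in> \<rat>"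
proof -
  have "(\<forall>i>j. coeff (pcompose f [:h, 1:]) i \<in> \<rat>) \<and>
      coeff (pcompose f [:h, 1:]) j - coeff f j \<in> \<rat> \<and>
      (\<forall>n. j = Suc n \<longrightarrow>
        coeff (pcompose f [:h, 1:]) n - coeff f n - real j * h * coeff f j \<in> \<rat>)"
    using assms(2)
  proof (induction f arbitrary: j)
    case 0
    show ?case by simp
  next
    case (pCons a p)
    define S where "S = pcompose p [:h, 1:]"
    have F: "coeff (pcompose (pCons a p) [:h, 1:]) i =
        (case i of 0 \<Rightarrow> a + h * coeff S 0 | Suc i' \<Rightarrow> h * coeff S (Suc i') + coeff S i')" for i
      by (simp add: pcompose_pCons S_def split: nat.split)
    show ?case
    proof (cases j)
      case 0
      have "coeff p i \<in> \<rat>" for i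
        using pCons.prems[of "Suc i"] 0 by simp
      then have "coeff p 0 \<in> \<rat>" "\<forall>i>0. coeff S i \<in> \<rat>" "coeff S 0 - coeff p 0 \<in> \<rat>"
        using pCons.IH[of 0] by (simp_all add: S_def)
      then have all: "coeff S i \<in> \<rat>" for i
        using Rats_add[of "coeff S 0 - coeff p 0" "coeff p 0"] by (cases "i = 0") auto
      show ?thesis
        unfolding 0 F using all h by (auto split: nat.split)
    next
      case (Suc j')
      have "coeff p i \<in> \<rat>" if "i > j'" for i
        using pCons.prems[of "Suc i"] Suc that by simp
      then have IH: "\<forall>i>j'. coeff S i \<in> \<rat>" "coeff S j' - coeff p j' \<in> \<rat>"
        "\<forall>n. j' = Suc n \<longrightarrow> coeff S n - coeff p n - real j' * h * coeff p j' \<in> \<rat>"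
        using pCons.IH[of j'] by (auto simp: S_def)
      have 1: "\<forall>i>j. coeff (pcompose (pCons a p) [:h, 1:]) i \<in> \<rat>"
        using IH(1) h by (auto simp: F Suc split: nat.split)
      have 2: "coeff (pcompose (pCons a p) [:h, 1:]) j - coeff (pCons a p) j \<in> \<rat>"
        using Rats_add[OF Rats_mult[OF h IH(1)[rule_format, of "Suc j'"]] IH(2)]
        by (simp add: F Suc algebra_simps)
      have "coeff (pcompose (pCons a p) [:h, 1:]) j' - coeff (pCons a p) j' -
          real j * h * coeff (pCons a p) j \<in> \<rat>"
      proof (cases j')
        case 0
        then show ?thesis
          unfolding F Suc using Rats_mult[OF h IH(2)]
          by (simp add: algebra_simps del: coeff_pcompose_0)
      next
        case (Suc n)
        then show ?thesis
          using Rats_add[OF Rats_mult[OF h IH(2)] IH(3)[rule_format, OF Suc]] \<open>j = Suc j'\<close>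
          by (simp add: F algebra_simps)
      qed
      then show ?thesis
        using 1 2 Suc by simp
    qed
  qed
  then show "i > j \<Longrightarrow> coeff F i \<in> \<rat>" "coeff F j - coeff f j \<in> \<rat>"
    "j = Suc n \<Longrightarrow> coeff F n - coeff f n - real j * h * coeff f j \<in> \<rat>"
    unfolding F_def by blast+
qed

text \<open>Shifting by \<open>q\<close> multiplies the mean by \<open>\<omega>\<close> but does not change it asymptotically.\<close>
lemma cesaro_twisted_periodic:
  fixes u :: "nat \<Rightarrow> complex"
  assumes bounded: "\<And>k. norm (u k) \<le> B"
    and twist: "\<And>k. u (k + q) = \<omega> * u k" and "\<omega> \<noteq> 1"
  shows "cesaro u \<longlonglongrightarrow> 0"
proof -
  have "(\<lambda>N. (\<omega> - 1) * cesaro u N) \<longlonglongrightarrow> 0"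
    using cesaro_shift[where f = u and h = q, OF bounded] by (simp add: twist cesaro_cmult left_diff_distrib)
  then show ?thesis
    using \<open>\<omega> \<noteq> 1\<close> tendsto_mult_left_iff[of "\<omega> - 1" "cesaro u" 0] by simp
qed

text \<open>Induction on the index \<open>j\<close> of the highest irrational coefficient rather than on the degree:
  rational coefficients above \<open>j\<close> do not prevent van der Corput differencing from lowering \<open>j\<close>. For
  \<open>j = 1\<close>, everything except the linear term is periodic modulo 1, so \<open>cesaro_twisted_periodic\<close>
  applies; the twist \<open>e (coeff f 1 * q)\<close> is not 1 because \<open>coeff f 1\<close> is irrational.\<close>
theorem weyl_exponential_sum:
  fixes f :: "real poly"
  assumes "j \<ge> 1" "coeff f j \<notin> \<rat>" "\<And>i. i > j \<Longrightarrow> coeff f i \<in> \<rat>"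
  shows "cesaro (\<lambda>k. e (poly f (real k))) \<longlonglongrightarrow> 0"
  using assms
proof (induction j arbitrary: f rule: nat_induct_at_least)
  case base
  define g where "g = f - [:coeff f 0, coeff f 1:]"
  have "coeff g i \<in> \<rat>" for i
    using base(2)[of i] by (auto simp: g_def coeff_pCons split: nat.split)
  then obtain q where q: "q > 0" "\<And>k. poly g (real (k + q)) - poly g (real k) \<in> \<int>"
    using rational_poly_periodic_mod_1[of g] by auto
  have f: "poly f x = coeff f 0 + coeff f 1 * x + poly g x" for x
    by (simp add: g_def)
  show ?case
  proof (rule cesaro_twisted_periodic)
    show "e (poly f (real (k + q))) = e (coeff f 1 * real q) * e (poly f (real k))" for k
    proof -
      have "poly f (real (k + q)) = coeff f 1 * real q + poly f (real k)
          + (poly g (real (k + q)) - poly g (real k))"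
        by (simp add: f algebra_simps)
      then show ?thesis
        using q(2)[of k] by (simp only: e_add e_Ints) simp
    qed
    have "coeff f 1 * real q \<notin> \<int>"
    proof
      assume "coeff f 1 * real q \<in> \<int>"
      then have "coeff f 1 * real q / real q \<in> \<rat>"
        using Ints_subset_Rats by (intro Rats_divide) auto
      then show False using base(1) q(1) by simp
    qed
    then show "e (coeff f 1 * real q) \<noteq> 1"
      by (simp add: e_eq_1_iff)
  qed (auto intro: order_refl)
next
  case (Suc j)
  show ?case
  proof (rule van_der_corput)
    fix h :: nat assume "h \<ge> 1"
    define F where "F = pcompose f [:real h, 1:]"
    have "e (poly f (real (k + h))) * cnj (e (poly f (real k))) = e (poly (F - f) (real k))" for k
      by (simp add: F_def poly_pcompose add.commute e_diff)
    moreover have "cesaro (\<lambda>k. e (poly (F - f) (real k))) \<longlonglongrightarrow> 0"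
    proof (rule Suc.IH)
      have "\<And>i. i > Suc j \<Longrightarrow> coeff f i \<in> \<rat>" "real h \<in> \<rat>"
        using Suc.prems by auto
      note trans = translate_coeffs_mod_Rats[where j = "Suc j", OF this(2,1), folded F_def]
      show "coeff (F - f) i \<in> \<rat>" if "i > j" for i
      proof (cases "i = Suc j")
        case True
        then show ?thesis using trans(2) by simp
      next
        case False
        then have "i > Suc j" using that by simp
        then show ?thesis using trans(1) Suc.prems(2) by simp
      qed
      show "coeff (F - f) j \<notin> \<rat>"
      proof
        assume "coeff (F - f) j \<in> \<rat>"
        then have "coeff (F - f) j - (coeff F j - coeff f j - real (Suc j) * real h * coeff f (Suc j)) \<in> \<rat>"
          using trans(3)[OF _ refl] by (rule Rats_diff)
        then have "(real (Suc j) * real h) * coeff f (Suc j) / (real (Suc j) * real h) \<in> \<rat>"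
          by (intro Rats_divide) auto
        then show False
          using Suc.prems(1) \<open>h \<ge> 1\<close> by simp
      qed
    qed
    ultimately show "cesaro (\<lambda>k. e (poly f (real (k + h))) * cnj (e (poly f (real k)))) \<longlonglongrightarrow> 0"
      by simp
  qed simp
qed

section \<open>The Fejer kernel and Weyl's criterion\<close>

text \<open>This is the Fejer kernel of order \<open>L\<close> divided by \<open>L\<close>. With this normalization its translates by the
  \<open>L\<close> points \<open>j / L\<close> add up to 1.\<close>
definition fejer :: "nat \<Rightarrow> real \<Rightarrow> real" where
  "fejer L y = (norm (\<Sum>p<L. e (real p * y)))\<^sup>2 / (real L)\<^sup>2"

lemma fejer_nonneg: "fejer L y \<ge> 0"
  by (simp add: fejer_def)

lemma fejer_expand:
  "complex_of_real (fejer L y) =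
    (\<Sum>p<L. \<Sum>q<L. e ((real p - real q) * y)) / of_real ((real L)\<^sup>2)"
proof -
  have "complex_of_real ((norm (\<Sum>p<L. e (real p * y)))\<^sup>2) =
      (\<Sum>p<L. \<Sum>q<L. e (real p * y) * cnj (e (real q * y)))"
    unfolding complex_norm_square by (simp add: sum_product)
  then show ?thesis
    by (simp add: fejer_def left_diff_distrib e_diff)
qed

text \<open>Orthogonality of the characters of the cyclic group of order \<open>L\<close>.\<close>
lemma sum_e_roots:
  assumes "p < L" "q < L"
  shows "(\<Sum>j<L. e (- ((real p - real q) * (real j / real L)))) = (if p = q then of_nat L else 0)"
proof (cases "p = q")
  case False
  define \<omega> where "\<omega> = e (- ((real p - real q) / real L))"
  have \<omega>: "e (- ((real p - real q) * (real j / real L))) = \<omega> ^ j" for j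
    by (simp add: \<omega>_def e_power mult_ac)
  have "\<omega> ^ L = 1"
    using assms by (simp add: \<omega>_def e_power)
  moreover have "\<omega> \<noteq> 1"
  proof
    assume "\<omega> = 1"
    then obtain z :: int where "- ((real p - real q) / real L) = of_int z"
      unfolding \<omega>_def e_eq_1_iff by (rule Ints_cases)
    then have "real q - real p = of_int z * real L"
      using assms by (simp add: field_simps)
    then have eq: "int q - int p = z * int L"
      by (metis of_int_diff of_int_eq_iff of_int_mult of_int_of_nat_eq)
    have "int L dvd int q - int p"
      by (simp add: eq)
    then have "\<bar>int L\<bar> \<le> \<bar>int q - int p\<bar>"
      by (rule dvd_imp_le_int[rotated]) (use False in simp)
    then show False using assms by linarith
  qed
  ultimately show ?thesis
    unfolding \<omega> using False by (simp add: geometric_sum)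
qed simp

lemma sum_fejer_nodes:
  assumes "L \<ge> 1"
  shows "(\<Sum>j<L. fejer L (y - real j / real L)) = 1"
proof -
  have "(\<Sum>j<L. \<Sum>p<L. \<Sum>q<L. e ((real p - real q) * (y - real j / real L))) =
      (\<Sum>p<L. \<Sum>q<L. \<Sum>j<L. e ((real p - real q) * (y - real j / real L)))"
    by (subst sum.swap, rule sum.cong[OF refl], rule sum.swap)
  also have "\<dots> = (\<Sum>p<L. \<Sum>q<L. e ((real p - real q) * y) *
      (\<Sum>j<L. e (- ((real p - real q) * (real j / real L)))))"
    by (simp add: sum_distrib_left right_diff_distrib flip: e_add)
  also have "\<dots> = (\<Sum>p<L. \<Sum>q<L. if p = q then of_nat L else 0)"
    by (intro sum.cong refl) (simp add: sum_e_roots del: times_divide_eq_right)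
  also have "\<dots> = of_real ((real L)\<^sup>2)"
    by (simp add: power2_eq_square)
  finally have "complex_of_real (\<Sum>j<L. fejer L (y - real j / real L)) = 1"
    using assms by (simp add: fejer_expand flip: sum_divide_distrib)
  then show ?thesis
    by (metis of_real_eq_1_iff)
qed

lemma fejer_le:
  assumes "L \<ge> 1" "0 < \<delta>" "\<delta> \<le> y" "y \<le> 1 - \<delta>"
  shows "fejer L y \<le> 1 / (2 * \<delta> * real L)\<^sup>2"
proof -
  have 4: "4 * \<delta> \<le> norm (e y - 1)"
    using assms by (intro norm_e_minus_1_ge) auto
  then have "e y \<noteq> 1"
    using assms by auto
  then have "(\<Sum>p<L. e (real p * y)) = (e y ^ L - 1) / (e y - 1)"
    by (simp add: geometric_sum flip: e_power)
  then have "norm (\<Sum>p<L. e (real p * y)) = norm (e y ^ L - 1) / norm (e y - 1)"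
    by (simp add: norm_divide)
  also have "\<dots> \<le> 2 / (4 * \<delta>)"
    using 4 assms norm_triangle_ineq4[of "e y ^ L" 1]
    by (intro frac_le) (auto simp: norm_power)
  finally have "norm (\<Sum>p<L. e (real p * y)) \<le> 1 / (2 * \<delta>)"
    by simp
  then have "(norm (\<Sum>p<L. e (real p * y)))\<^sup>2 \<le> (1 / (2 * \<delta>))\<^sup>2"
    by (intro power_mono) auto
  then have "fejer L y \<le> (1 / (2 * \<delta>))\<^sup>2 / (real L)\<^sup>2"
    unfolding fejer_def by (intro divide_right_mono) auto
  then show ?thesis
    by (simp add: power_divide power_mult_distrib)
qed

lemma fejer_minus: "fejer L (- y) = fejer L y"
proof -
  have "(\<Sum>p<L. e (real p * - y)) = cnj (\<Sum>p<L. e (real p * y))"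
    by (simp add: cnj_e)
  then show ?thesis
    by (simp only: fejer_def complex_mod_cnj)
qed

lemma fejer_add_int: "fejer L (of_int z + y) = fejer L y"
  by (simp add: fejer_def distrib_left e_add)

text \<open>Of the \<open>L\<^sup>2\<close> frequencies \<open>p - q\<close> in the expansion of the kernel, only the \<open>L\<close> zero ones have a
  nonzero mean.\<close>
lemma cesaro_fejer:
  fixes x :: "nat \<Rightarrow> real"
  assumes weyl: "\<And>h. h \<ge> 1 \<Longrightarrow> cesaro (\<lambda>k. e (real h * x k)) \<longlonglongrightarrow> 0" and L: "L \<ge> 1"
  shows "cesaro (\<lambda>k. fejer L (x k - c)) \<longlonglongrightarrow> 1 / real L"
proof -
  have less: "cesaro (\<lambda>k. e ((real p - real q) * x k)) \<longlonglongrightarrow> 0" if "q < p" for p q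
    using weyl[of "p - q"] that by (simp add: of_nat_diff)
  have neq: "cesaro (\<lambda>k. e ((real p - real q) * x k)) \<longlonglongrightarrow> 0" if "p \<noteq> q" for p q
  proof (cases "q < p")
    case False
    have "(\<lambda>N. cnj (cesaro (\<lambda>k. e ((real q - real p) * x k)) N)) \<longlonglongrightarrow> cnj 0"
      using that False by (intro tendsto_cnj less) auto
    moreover have "cnj (cesaro (\<lambda>k. e ((real q - real p) * x k)) N) =
        cesaro (\<lambda>k. e ((real p - real q) * x k)) N" for N
      by (simp add: cesaro_def cnj_e left_diff_distrib)
    ultimately show ?thesis by simp
  qed (rule less)
  have pair: "cesaro (\<lambda>k. e ((real p - real q) * (x k - c))) \<longlonglongrightarrow> (if p = q then 1 else 0)" for p q
  proof (cases "p = q")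
    case True
    then show ?thesis by (simp add: tendsto_cesaro_const)
  next
    case False
    have "cesaro (\<lambda>k. e ((real p - real q) * (x k - c))) =
        (\<lambda>N. e (- ((real p - real q) * c)) * cesaro (\<lambda>k. e ((real p - real q) * x k)) N)"
      by (simp add: fun_eq_iff right_diff_distrib flip: cesaro_cmult e_add)
    then show ?thesis
      using False tendsto_mult_right_zero[OF neq[OF False]] by simp
  qed
  have "cesaro (\<lambda>k. complex_of_real (fejer L (x k - c))) =
      (\<lambda>N. (1 / of_real ((real L)\<^sup>2)) *
        (\<Sum>p<L. \<Sum>q<L. cesaro (\<lambda>k. e ((real p - real q) * (x k - c))) N))"
    unfolding cesaro_sum[symmetric] cesaro_cmult[symmetric] by (simp add: fejer_expand fun_eq_iff)
  moreover have "\<dots> \<longlonglongrightarrow>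
      (1 / of_real ((real L)\<^sup>2)) * (\<Sum>p<L. \<Sum>q<L. if p = q then 1 else 0)"
    by (intro tendsto_intros pair)
  moreover have "(1 / complex_of_real ((real L)\<^sup>2)) * (\<Sum>p<L. \<Sum>q<L. if p = q then 1 else 0) =
      of_real (1 / real L)"
    using L by (simp add: power2_eq_square)
  ultimately have "cesaro (\<lambda>k. complex_of_real (fejer L (x k - c))) \<longlonglongrightarrow> of_real (1 / real L)"
    by simp
  then show ?thesis
    unfolding cesaro_of_real[abs_def] tendsto_of_real_iff .
qed

text \<open>The majorant of an arc. The nodes \<open>c + j / L\<close> with \<open>j < R + 2 s\<close> fill the arc
  \<open>[i/m, (i+1)/m)\<close> of length \<open>R / L\<close> together with a margin \<open>s / L\<close> on either side. All \<open>L\<close> kernels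
  together sum to 1; at a point of the arc, each of the omitted ones is centred at distance at least
  \<open>s / L\<close> and is therefore at most \<open>1 / (4 s\<^sup>2)\<close>.\<close>
lemma residue_indicator_le_fejer:
  fixes m :: nat and i :: int and y :: real
  assumes "m \<ge> 1" "R \<ge> 1" "s \<ge> 1"
  defines "L \<equiv> m * R"
  defines "c \<equiv> (of_int i * real R - real s) / real L"
  shows "of_bool [\<lfloor>y\<rfloor> = i] (mod int m) \<le>
    (\<Sum>j<R + 2 * s. fejer L (y / real m - (c + real j / real L))) + real L / (4 * (real s)\<^sup>2)"
proof (cases "[\<lfloor>y\<rfloor> = i] (mod int m)")
  case False
  then show ?thesis
    by (simp add: sum_nonneg fejer_nonneg)
next
  case True
  have L: "L \<ge> 1"
    using assms by (simp add: L_def)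
  let ?F = "\<lambda>j. fejer L (y / real m - (c + real j / real L))"
  have total: "(\<Sum>j<L. ?F j) = 1"
    using sum_fejer_nodes[OF L, of "y / real m - c"] by (simp add: algebra_simps)
  obtain z where z: "\<lfloor>y\<rfloor> = i + int m * z"
    using True by (metis cong_iff_lin cong_sym)
  \<comment> \<open>Modulo 1, the point \<open>y / m\<close> is \<open>(i + \<theta>) / m\<close>, and \<open>\<theta>\<close> is its relative position in the arc.\<close>
  define \<theta> where "\<theta> = frac y"
  have \<theta>: "0 \<le> \<theta>" "\<theta> < 1" "y = of_int i + real m * of_int z + \<theta>"
    using z frac_lt_1[of y] frac_ge_0[of y] by (simp_all add: \<theta>_def) (simp add: frac_def)
  have far: "?F j \<le> 1 / (4 * (real s)\<^sup>2)" if j: "R + 2 * s \<le> j" "j < L" for j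
  proof -
    define w where "w = (real j - real s - \<theta> * real R) / real L"
    have "y / real m - (c + real j / real L) = of_int z + - w"
      using assms(1,2) by (simp add: \<theta>(3) w_def c_def L_def field_simps)
    then have "?F j = fejer L w"
      by (simp only: fejer_add_int fejer_minus)
    also have "\<dots> \<le> 1 / (2 * (real s / real L) * real L)\<^sup>2"
    proof (rule fejer_le[OF L])
      have "\<theta> * real R \<le> real R" "0 \<le> \<theta> * real R"
        using \<theta> by (auto simp: mult_left_le_one_le)
      then have 1: "real s \<le> real j - real s - \<theta> * real R"
        and 2: "real j - real s - \<theta> * real R \<le> real L - real s"
        using j by linarith+
      show "real s / real L \<le> w"
        unfolding w_def using 1 by (intro divide_right_mono) auto
      have "w \<le> (real L - real s) / real L"
        unfolding w_def using 2 by (intro divide_right_mono) auto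
      then show "w \<le> 1 - real s / real L"
        using L by (simp add: diff_divide_distrib)
    qed (use L assms in auto)
    also have "\<dots> = 1 / (4 * (real s)\<^sup>2)"
      using L by (simp add: power_mult_distrib)
    finally show ?thesis .
  qed
  have "1 \<le> (\<Sum>j<R + 2 * s. ?F j) + (\<Sum>j\<in>{R + 2 * s..<L}. ?F j)"
  proof -
    have "(\<Sum>j<L. ?F j) \<le> (\<Sum>j\<in>{..<R + 2 * s} \<union> {R + 2 * s..<L}. ?F j)"
      by (intro sum_mono2) (auto simp: fejer_nonneg)
    also have "\<dots> = (\<Sum>j<R + 2 * s. ?F j) + (\<Sum>j\<in>{R + 2 * s..<L}. ?F j)"
      by (intro sum.union_disjoint) auto
    finally show ?thesis
      by (simp add: total)
  qed
  also have "(\<Sum>j\<in>{R + 2 * s..<L}. ?F j) \<le> real (card {R + 2 * s..<L}) * (1 / (4 * (real s)\<^sup>2))"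
    by (intro sum_bounded_above far) auto
  also have "\<dots> \<le> real L * (1 / (4 * (real s)\<^sup>2))"
    by (intro mult_right_mono) auto
  finally show ?thesis
    using True by simp
qed

lemma ud_mod_iff_cesaro:
  "ud_mod a m \<longleftrightarrow>
    (\<forall>i. cesaro (\<lambda>k. of_bool [a k = i] (mod m)) \<longlonglongrightarrow> 1 / real_of_int m)"
proof -
  have "(\<lambda>N. real (card {k \<in> {1..N}. [a k = i] (mod m)}) / real N) =
      cesaro (\<lambda>k. of_bool [a k = i] (mod m))" for i
    by (simp add: fun_eq_iff cesaro_def divide_inverse_commute Int_def)
  then show ?thesis
    by (simp add: ud_mod_def)
qed

lemma sum_residue_indicators:
  fixes m :: int
  assumes "m \<ge> 1"
  shows "(\<Sum>i\<in>{0..<m}. of_bool [a = i] (mod m)) = (1::real)"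
proof -
  have "(\<Sum>i\<in>{0..<m}. of_bool [a = i] (mod m)) = (\<Sum>i\<in>{0..<m}. if i = a mod m then 1 else (0::real))"
    using assms by (intro sum.cong) (auto simp: cong_def)
  then show ?thesis
    using assms by simp
qed

text \<open>Because the total is fixed, a term that stayed below \<open>c\<close> would push another one above it.
  This spares the construction of minorants.\<close>
lemma tendsto_of_limsup_le_and_sum:
  fixes a :: "'i \<Rightarrow> nat \<Rightarrow> real"
  assumes I: "finite I" "i \<in> I"
    and upper: "\<And>j \<epsilon>. j \<in> I \<Longrightarrow> \<epsilon> > 0 \<Longrightarrow> \<forall>\<^sub>F N in sequentially. a j N \<le> c + \<epsilon>"
    and total: "\<forall>\<^sub>F N in sequentially. (\<Sum>j\<in>I. a j N) = real (card I) * c"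
  shows "a i \<longlonglongrightarrow> c"
proof (rule tendstoI)
  fix \<epsilon> :: real assume "\<epsilon> > 0"
  define n where "n = real (card I)"
  have n: "n \<ge> 1"
    using I by (simp add: n_def Suc_le_eq card_gt_0_iff) blast
  have "\<forall>\<^sub>F N in sequentially. \<forall>j\<in>I. a j N \<le> c + \<epsilon> / (2 * n)"
    using I n \<open>\<epsilon> > 0\<close> by (intro eventually_ball_finite ballI upper) auto
  then show "\<forall>\<^sub>F N in sequentially. dist (a i N) c < \<epsilon>"
    using total
  proof eventually_elim
    case (elim N)
    have "(\<Sum>j\<in>I. a j N) = a i N + (\<Sum>j\<in>I - {i}. a j N)"
      using I by (rule sum.remove)
    moreover have "(\<Sum>j\<in>I - {i}. a j N) \<le> real (card (I - {i})) * (c + \<epsilon> / (2 * n))"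
      using elim by (intro sum_bounded_above) auto
    moreover have "real (card (I - {i})) = n - 1"
      using I n by (simp add: n_def of_nat_diff)
    ultimately have "n * c \<le> a i N + (n - 1) * (c + \<epsilon> / (2 * n))"
      using elim by (simp add: n_def)
    then have "c \<le> a i N + (n - 1) * (\<epsilon> / (2 * n))"
      by (simp add: algebra_simps)
    also have "(n - 1) * (\<epsilon> / (2 * n)) \<le> n * (\<epsilon> / (2 * n))"
      using n \<open>\<epsilon> > 0\<close> by (intro mult_right_mono) auto
    also have "\<dots> = \<epsilon> / 2"
      using n by simp
    finally have "c \<le> a i N + \<epsilon> / 2" by simp
    moreover have "a i N \<le> c + \<epsilon> / 2"
    proof -
      have "\<epsilon> / (2 * n) \<le> \<epsilon> / 2"
        using n \<open>\<epsilon> > 0\<close> by (intro divide_left_mono) auto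
      then show ?thesis using elim I by fastforce
    qed
    ultimately show ?case
      using \<open>\<epsilon> > 0\<close> by (simp add: dist_real_def)
  qed
qed

text \<open>One half of Weyl's criterion, for the partition of the circle into the \<open>m\<close> arcs that correspond to the
  residues of the floor.\<close>
theorem weyl_criterion_ud_mod:
  fixes y :: "nat \<Rightarrow> real" and m :: nat
  assumes m: "m \<ge> 1"
    and weyl: "\<And>h. h \<ge> 1 \<Longrightarrow> cesaro (\<lambda>k. e (real h * (y k / real m))) \<longlonglongrightarrow> 0"
  shows "ud_mod (\<lambda>k. \<lfloor>y k\<rfloor>) (int m)"
proof -
  define f where "f i k = (of_bool [\<lfloor>y k\<rfloor> = i] (mod int m) :: real)" for i k
  have upper: "\<forall>\<^sub>F N in sequentially. cesaro (f i) N \<le> 1 / real m + \<epsilon>" if "\<epsilon> > 0" for i \<epsilon>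
  proof -
    \<comment> \<open>Width \<open>R = t\<^sup>3\<close> and margin \<open>s = t\<^sup>2\<close> make both errors of order \<open>1/t\<close>: the margins
      add the relative amount \<open>2 s / R = 2 / t\<close>, and the omitted kernels add
      \<open>L / (4 s\<^sup>2) = m / (4 t)\<close>. The middle term of \<open>C\<close> pays for the convergence of the means.\<close>
    define C where "C = 2 / real m + 1 + real m / 4"
    define t where "t = nat \<lceil>C / \<epsilon>\<rceil> + 1"
    have t: "t \<ge> 1" "C / \<epsilon> \<le> real t"
      unfolding t_def by linarith+
    define L where "L = m * t ^ 3"
    have L: "L \<ge> 1"
      using m t by (simp add: L_def)
    define c where "c = (of_int i * real (t ^ 3) - real (t ^ 2)) / real L"
    define G where "G k = (\<Sum>j<t ^ 3 + 2 * t ^ 2. fejer L (y k / real m - (c + real j / real L)))" for k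
    have maj: "f i k \<le> G k + real m / (4 * real t)" for k
      using residue_indicator_le_fejer[of m "t ^ 3" "t ^ 2" "y k" i] m t
      by (simp add: f_def G_def c_def L_def power2_eq_square power3_eq_cube)
    have "(\<lambda>N. \<Sum>j<t ^ 3 + 2 * t ^ 2. cesaro (\<lambda>k. fejer L (y k / real m - (c + real j / real L))) N)
        \<longlonglongrightarrow> (\<Sum>j<t ^ 3 + 2 * t ^ 2. 1 / real L)"
      by (intro tendsto_sum cesaro_fejer weyl L)
    moreover have "(\<Sum>j<t ^ 3 + 2 * t ^ 2. 1 / real L) = 1 / real m + 2 / (real m * real t)"
      using m t by (simp add: L_def field_simps power2_eq_square power3_eq_cube)
    ultimately have "cesaro G \<longlonglongrightarrow> 1 / real m + 2 / (real m * real t)"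
      by (simp add: G_def[abs_def] cesaro_sum[abs_def])
    then have "\<forall>\<^sub>F N in sequentially. cesaro G N < 1 / real m + 2 / (real m * real t) + 1 / real t"
      by (rule order_tendstoD) (use t in simp)
    then show ?thesis
      using eventually_ge_at_top[of 1]
    proof eventually_elim
      case (elim N)
      have "cesaro (f i) N \<le> cesaro (\<lambda>k. G k + real m / (4 * real t)) N"
        by (intro cesaro_mono maj)
      also have "\<dots> = cesaro G N + real m / (4 * real t)"
        using elim by (simp add: cesaro_add cesaro_const)
      also have "\<dots> \<le> 1 / real m + C / real t"
        using elim t by (simp add: C_def add_divide_distrib)
      also have "C / real t \<le> \<epsilon>"
        using t \<open>\<epsilon> > 0\<close> by (simp add: field_simps)
      finally show ?case by simp
    qed
  qed
  have "cesaro (f i) \<longlonglongrightarrow> 1 / real m" for i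
  proof -
    have "cesaro (f (i mod int m)) \<longlonglongrightarrow> 1 / real m"
    proof (rule tendsto_of_limsup_le_and_sum[of "{0..<int m}" _ "\<lambda>i. cesaro (f i)"])
      have "(\<Sum>j\<in>{0..<int m}. cesaro (f j) N) = 1" if "N \<ge> 1" for N
      proof -
        have "(\<Sum>j\<in>{0..<int m}. f j k) = 1" for k
          unfolding f_def using m by (intro sum_residue_indicators) simp
        then show ?thesis
          using that by (simp add: cesaro_const flip: cesaro_sum)
      qed
      then show "\<forall>\<^sub>F N in sequentially.
          (\<Sum>j\<in>{0..<int m}. cesaro (f j) N) = real (card {0..<int m}) * (1 / real m)"
        using m by (auto intro!: eventually_sequentiallyI[of 1])
    qed (use m upper in auto)
    moreover have "f (i mod int m) = f i"
      by (simp add: f_def fun_eq_iff cong_def)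
    ultimately show ?thesis by simp
  qed
  then show ?thesis
    by (simp add: ud_mod_iff_cesaro f_def[abs_def])
qed

section \<open>Floors of polynomials\<close>

lemma cesaro_ud_window:
  fixes a :: "nat \<Rightarrow> int"
  assumes "ud_mod a m"
  shows "cesaro (\<lambda>k. \<Sum>h<H. of_bool [a (k + h) = i] (mod m)) \<longlonglongrightarrow> real H / real_of_int m"
proof -
  define f where "f k = (of_bool [a k = i] (mod m) :: real)" for k
  have bounded: "norm (f k) \<le> 1" for k
    by (simp add: f_def)
  have window: "(\<lambda>N. cesaro (\<lambda>k. \<Sum>h<H. f (k + h)) N - real H *\<^sub>R cesaro f N) \<longlonglongrightarrow> 0"
    using cesaro_window[where f = f and s = 1 and H = H, OF bounded] by simp
  have "cesaro f \<longlonglongrightarrow> 1 / real_of_int m"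
    using assms unfolding ud_mod_iff_cesaro f_def[abs_def] by blast
  then have "(\<lambda>N. real H *\<^sub>R cesaro f N) \<longlonglongrightarrow> real H *\<^sub>R (1 / real_of_int m)"
    by (intro tendsto_intros)
  from tendsto_add[OF window this] show ?thesis
    by (simp add: f_def)
qed

text \<open>A window of length \<open>q\<close> contains the same number of zeros modulo \<open>m\<close> wherever it starts, so the
  frequency \<open>1/m\<close> is an integer divided by \<open>q\<close>.\<close>
lemma ud_mod_periodic_imp_dvd:
  fixes a :: "nat \<Rightarrow> int"
  assumes ud: "ud_mod a m" and "m \<ge> 1"
    and period: "\<And>k. [a (k + q) = a k] (mod m)"
  shows "m dvd int q"
proof -
  define W where "W k = (\<Sum>h<q. of_bool [a (k + h) = 0] (mod m) :: real)" for k
  have "W (Suc k) = W k" for k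
  proof -
    have "W (Suc k) + of_bool [a k = 0] (mod m) = (\<Sum>h<Suc q. of_bool [a (k + h) = 0] (mod m))"
      unfolding W_def by (subst sum.lessThan_Suc_shift) simp
    also have "\<dots> = W k + of_bool [a (k + q) = 0] (mod m)"
      by (simp add: W_def)
    also have "[a (k + q) = 0] (mod m) \<longleftrightarrow> [a k = 0] (mod m)"
      using period[of k] by (simp add: cong_def)
    finally show ?thesis by simp
  qed
  then have W: "W k = W 0" for k
    by (induction k) auto
  have "cesaro W \<longlonglongrightarrow> real q / real_of_int m"
    unfolding W_def by (rule cesaro_ud_window[OF ud])
  moreover have "cesaro W \<longlonglongrightarrow> W 0"
  proof -
    have "W = (\<lambda>k. W 0)"
      using W by (rule ext)
    then show ?thesis
      using tendsto_cesaro_const[of "W 0"] by metis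
  qed
  ultimately have "real q / real_of_int m = W 0"
    by (rule LIMSEQ_unique)
  also have "W 0 = of_int (\<Sum>h<q. of_bool [a h = 0] (mod m))"
    by (simp add: W_def)
  finally have "real_of_int (int q) = of_int (m * (\<Sum>h<q. of_bool [a h = 0] (mod m)))"
    using \<open>m \<ge> 1\<close> by (simp add: field_simps)
  then have "int q = m * (\<Sum>h<q. of_bool [a h = 0] (mod m))"
    by (simp only: of_int_eq_iff)
  then show ?thesis by simp
qed

text \<open>Every window of length \<open>T\<close> meets the progression, so the residue \<open>i\<close> has frequency at
  least \<open>1/T\<close>.\<close>
lemma ud_mod_constant_on_progression_imp_le:
  fixes a :: "nat \<Rightarrow> int"
  assumes ud: "ud_mod a m" and "m \<ge> 1" and T: "T \<ge> 1"
    and const: "\<And>k. [int k = k\<^sub>0] (mod int T) \<Longrightarrow> [a k = i] (mod m)"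
  shows "m \<le> int T"
proof -
  define W where "W k = (\<Sum>h<T. of_bool [a (k + h) = i] (mod m) :: real)" for k
  have W: "1 \<le> W k" for k
  proof -
    define h where "h = nat ((k\<^sub>0 - int k) mod int T)"
    have h: "h < T" "int h = (k\<^sub>0 - int k) mod int T"
      using T by (auto simp: h_def nat_less_iff)
    have "[int (k + h) = k\<^sub>0] (mod int T)"
      unfolding of_nat_add h(2) cong_def by (simp add: mod_add_right_eq)
    then have "(of_bool [a (k + h) = i] (mod m) :: real) = 1"
      using const by simp
    moreover have "of_bool [a (k + h) = i] (mod m) \<le> W k"
      unfolding W_def using h by (intro member_le_sum) auto
    ultimately show ?thesis by simp
  qed
  have "cesaro W \<longlonglongrightarrow> real T / real_of_int m"
    unfolding W_def by (rule cesaro_ud_window[OF ud])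
  moreover have "1 \<le> cesaro W N" if "N \<ge> 1" for N
    using cesaro_mono[of "\<lambda>_. 1" W N] W that by (simp add: cesaro_const)
  ultimately have "1 \<le> real T / real_of_int m"
    by (intro LIMSEQ_le_const) auto
  then show ?thesis
    using \<open>m \<ge> 1\<close> by (simp add: field_simps)
qed

lemma ud_in_Z_irrational:
  fixes P :: "real poly"
  assumes "i \<ge> 1" "coeff P i \<notin> \<rat>"
  shows "ud_in_Z (\<lambda>k. \<lfloor>poly P (real k)\<rfloor>)"
  unfolding ud_in_Z_def
proof (intro allI impI)
  fix m :: int assume "m \<ge> 2"
  define n where "n = nat m"
  have n: "m = int n" "n \<ge> 1"
    using \<open>m \<ge> 2\<close> by (auto simp: n_def)
  \<comment> \<open>The exponential sum theorem needs the highest irrational coefficient.\<close>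
  define J where "J = {j. coeff P j \<notin> \<rat>}"
  have "J \<subseteq> {..degree P}"
    by (auto simp: J_def intro!: le_degree)
  then have J: "finite J"
    by (rule finite_subset) simp
  define j where "j = Max J"
  have "i \<in> J"
    using assms by (simp add: J_def)
  then have "j \<in> J" "i \<le> j"
    using J by (auto simp: j_def intro: Max_in)
  have above: "coeff P k \<in> \<rat>" if "k > j" for k
    using Max_ge[OF J, of k] that by (auto simp: j_def J_def)
  show "ud_mod (\<lambda>k. \<lfloor>poly P (real k)\<rfloor>) m"
    unfolding n(1)
  proof (rule weyl_criterion_ud_mod[OF n(2)])
    fix h :: nat assume "h \<ge> 1"
    define r where "r = real h / real n"
    have r: "r \<in> \<rat>" "r \<noteq> 0"
      using \<open>h \<ge> 1\<close> n by (auto simp: r_def)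
    have "cesaro (\<lambda>k. e (poly (smult r P) (real k))) \<longlonglongrightarrow> 0"
    proof (rule weyl_exponential_sum)
      show "j \<ge> 1" using assms \<open>i \<le> j\<close> by simp
      show "coeff (smult r P) j \<notin> \<rat>"
      proof
        assume "coeff (smult r P) j \<in> \<rat>"
        then have "coeff (smult r P) j / r \<in> \<rat>"
          using r by (intro Rats_divide)
        then show False
          using r \<open>j \<in> J\<close> by (simp add: J_def)
      qed
      show "coeff (smult r P) k \<in> \<rat>" if "k > j" for k
        using above[OF that] r by simp
    qed
    then show "cesaro (\<lambda>k. e (real h * (poly P (real k) / real n))) \<longlonglongrightarrow> 0"
      by (simp add: r_def)
  qed
qed

text \<open>A window of \<open>m\<close> steps of length \<open>\<bar>l\<bar>\<close> meets each residue exactly once, since each step changes the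
  floor by the sign of \<open>l\<close>.\<close>
lemma ud_in_Z_slope_one_over_int:
  fixes l :: int
  assumes "l \<noteq> 0"
  shows "ud_in_Z (\<lambda>k. \<lfloor>c + real k / of_int l\<rfloor>)"
  unfolding ud_in_Z_def ud_mod_iff_cesaro
proof (intro allI impI)
  fix m i :: int assume "m \<ge> 2"
  define a where "a k = \<lfloor>c + real k / of_int l\<rfloor>" for k
  define f where "f k = (of_bool [a k = i] (mod m) :: real)" for k
  define s where "s = nat \<bar>l\<bar>"
  have s: "real s / of_int l = of_int (sgn l)"
    using assms by (simp add: s_def sgn_if)
  have a: "a (k + s * h) = a k + sgn l * int h" for k h
  proof -
    have "c + real (k + s * h) / of_int l = c + real k / of_int l + of_int (sgn l * int h)"
      by (simp add: add_divide_distrib flip: s)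
    then show ?thesis
      unfolding a_def by (simp only: floor_add_int)
  qed
  have "(\<Sum>h<nat m. f (k + s * h)) = 1" for k
  proof -
    define h\<^sub>0 where "h\<^sub>0 = nat ((sgn l * (i - a k)) mod m)"
    have h0: "h\<^sub>0 < nat m" "int h\<^sub>0 = (sgn l * (i - a k)) mod m"
      using \<open>m \<ge> 2\<close> by (auto simp: h\<^sub>0_def)
    have "[a k + sgn l * int h = i] (mod m) \<longleftrightarrow> h = h\<^sub>0" if "h < nat m" for h
    proof -
      have "[a k + sgn l * int h = i] (mod m) \<longleftrightarrow> m dvd a k + sgn l * int h - i"
        by (rule cong_iff_dvd_diff)
      also have "\<dots> \<longleftrightarrow> m dvd int h - sgn l * (i - a k)"
      proof (cases "l > 0")
        case True
        then show ?thesis by (simp add: algebra_simps)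
      next
        case False
        then have "int h - sgn l * (i - a k) = - (a k + sgn l * int h - i)"
          using assms by (simp add: sgn_if)
        then show ?thesis by (simp only: dvd_minus_iff)
      qed
      also have "\<dots> \<longleftrightarrow> int h mod m = (sgn l * (i - a k)) mod m"
        by (simp add: mod_eq_dvd_iff)
      also have "\<dots> \<longleftrightarrow> h = h\<^sub>0"
        using that by (simp flip: h0(2))
      finally show ?thesis .
    qed
    then have "(\<Sum>h<nat m. f (k + s * h)) = (\<Sum>h<nat m. if h = h\<^sub>0 then 1 else 0)"
      by (intro sum.cong) (auto simp: f_def a)
    then show ?thesis
      using h0 by simp
  qed
  then have "(\<lambda>N. cesaro (\<lambda>k. 1) N - real (nat m) *\<^sub>R cesaro f N) \<longlonglongrightarrow> 0"
    using cesaro_window[where f = f and B = 1 and s = s and H = "nat m"] by (simp add: f_def)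
  from tendsto_diff[OF tendsto_cesaro_const[of "1::real"] this]
  have "(\<lambda>N. real_of_int m * cesaro f N) \<longlonglongrightarrow> 1"
    using \<open>m \<ge> 2\<close> by simp
  then have "(\<lambda>N. real_of_int m * cesaro f N / real_of_int m) \<longlonglongrightarrow> 1 / real_of_int m"
    by (intro tendsto_divide) (use \<open>m \<ge> 2\<close> in auto)
  then show "cesaro (\<lambda>k. of_bool [\<lfloor>c + real k / of_int l\<rfloor> = i] (mod m)) \<longlonglongrightarrow> 1 / real_of_int m"
    using \<open>m \<ge> 2\<close> by (simp add: f_def[abs_def] a_def)
qed

lemma int_poly_unbounded:
  fixes p :: "int poly"
  assumes "degree p \<ge> 1"
  shows "\<exists>k::nat. \<bar>poly p (int k)\<bar> > B"
proof (rule ccontr)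
  assume "\<not> ?thesis"
  then have bounded: "\<bar>poly p (int k)\<bar> \<le> B" for k
    by (simp add: not_less)
  have "range int \<subseteq> (\<Union>c\<in>{-B..B}. {x. poly (p - [:c:]) x = 0})"
  proof safe
    fix k
    show "int k \<in> (\<Union>c\<in>{-B..B}. {x. poly (p - [:c:]) x = 0})"
      using bounded[of k] by (intro UN_I[of "poly p (int k)"]) auto
  qed
  moreover have "finite (\<Union>c\<in>{-B..B}. {x. poly (p - [:c:]) x = 0})"
  proof (intro finite_UN_I poly_roots_finite notI)
    fix c assume "p - [:c:] = 0"
    then have "p = [:c:]" by simp
    then show False using assms by simp
  qed simp
  ultimately have "finite (range int)"
    by (rule finite_subset)
  then show False
    using finite_imageD[of int UNIV] by simp
qed

text \<open>With \<open>P = c + R/q\<close> and \<open>D = R'(k\<^sub>0)\<close>, the second-order expansion of \<open>R\<close> at \<open>k\<^sub>0\<close> with increment \<open>qDt\<close>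
  has both its linear and its quadratic part divisible by \<open>q D\<^sup>2\<close>. So modulo \<open>D\<^sup>2\<close> the floors are
  constant on a progression of modulus \<open>q\<bar>D\<bar>\<close>, which is smaller than \<open>D\<^sup>2\<close> once \<open>\<bar>D\<bar> > q\<close>.\<close>
lemma not_ud_in_Z_rational_nonlinear:
  fixes P :: "real poly"
  assumes rat: "\<And>i. i \<ge> 1 \<Longrightarrow> coeff P i \<in> \<rat>" and deg: "degree P \<ge> 2"
  shows "\<not> ud_in_Z (\<lambda>k. \<lfloor>poly P (real k)\<rfloor>)"
proof
  assume ud: "ud_in_Z (\<lambda>k. \<lfloor>poly P (real k)\<rfloor>)"
  define g where "g = P - [:coeff P 0:]"
  have "coeff g i \<in> \<rat>" for i
    using rat[of i] by (cases i) (auto simp: g_def)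
  then obtain q R where q: "q > 0" and R: "smult (real q) g = map_poly of_int (R::int poly)"
    using clear_denominators by blast
  have P: "real q * poly P (real k) = real q * coeff P 0 + of_int (poly R (int k))" for k
    using arg_cong[OF R, of "\<lambda>p. poly p (real k)"] poly_map_of_int[of R "int k"]
    by (simp add: g_def algebra_simps)
  have "degree g = degree P"
    using deg degree_add_eq_left[of "- [:coeff P 0:]" P] by (simp add: g_def del: minus_pCons)
  then have "degree R = degree P"
    using arg_cong[OF R, of degree] q by (simp add: degree_map_poly)
  then have "degree (pderiv R) \<ge> 1"
    using deg by (simp add: degree_pderiv)
  then obtain k\<^sub>0 :: nat where k0: "\<bar>poly (pderiv R) (int k\<^sub>0)\<bar> > int q"
    using int_poly_unbounded by blast
  define D where "D = poly (pderiv R) (int k\<^sub>0)"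
  have D: "\<bar>D\<bar> > int q"
    using k0 by (simp add: D_def)
  define T where "T = q * nat \<bar>D\<bar>"
  have "D\<^sup>2 \<le> int T"
  proof (rule ud_mod_constant_on_progression_imp_le)
    have "\<bar>D\<bar> * \<bar>D\<bar> \<ge> 2 * 1"
      using D q by (intro mult_mono) auto
    then have "D\<^sup>2 \<ge> 2"
      by (simp add: power2_eq_square)
    then show "ud_mod (\<lambda>k. \<lfloor>poly P (real k)\<rfloor>) (D\<^sup>2)" "D\<^sup>2 \<ge> 1"
      using ud by (auto simp: ud_in_Z_def)
    show "T \<ge> 1"
      using q D by (simp add: T_def)
    show "[\<lfloor>poly P (real k)\<rfloor> = \<lfloor>poly P (real k\<^sub>0)\<rfloor>] (mod D\<^sup>2)" if k: "[int k = int k\<^sub>0] (mod int T)" for k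
    proof -
      obtain s where "int k = int k\<^sub>0 + int T * s"
        using k by (metis cong_iff_lin cong_sym)
      moreover have "int T = int q * (D * sgn D)"
        by (simp add: T_def sgn_if)
      moreover define t where "t = s * sgn D"
      ultimately have t: "int k = int k\<^sub>0 + int q * D * t"
        by (simp add: mult_ac)
      obtain w where "poly R (int k\<^sub>0 + int q * D * t) = poly R (int k\<^sub>0) + int q * D * t * D
          + (int q * D * t)\<^sup>2 * w"
        unfolding D_def using poly_Taylor_square_remainder by blast
      then have "poly R (int k) = poly R (int k\<^sub>0) + int q * (D\<^sup>2 * (t + int q * t\<^sup>2 * w))"
        by (simp add: t power2_eq_square algebra_simps)
      then have "real q * poly P (real k) =
          real q * (poly P (real k\<^sub>0) + of_int (D\<^sup>2 * (t + int q * t\<^sup>2 * w)))"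
        by (simp only: P) (simp add: P algebra_simps)
      then have "poly P (real k) = poly P (real k\<^sub>0) + of_int (D\<^sup>2 * (t + int q * t\<^sup>2 * w))"
        using q by (simp only: mult_cancel_left) simp
      then have "\<lfloor>poly P (real k)\<rfloor> = \<lfloor>poly P (real k\<^sub>0)\<rfloor> + D\<^sup>2 * (t + int q * t\<^sup>2 * w)"
        by (simp only: floor_add_int)
      then show ?thesis
        by (simp add: cong_iff_dvd_diff)
    qed
  qed
  then have "\<bar>D\<bar> * \<bar>D\<bar> \<le> int q * \<bar>D\<bar>"
    by (simp add: T_def power2_eq_square)
  moreover have "int q * \<bar>D\<bar> < \<bar>D\<bar> * \<bar>D\<bar>"
    using D by (intro mult_strict_right_mono) auto
  ultimately show False
    by linarith
qed

text \<open>Write \<open>r = a/b\<close> in lowest terms. Modulo a divisor of \<open>a\<close> the floors have period \<open>b\<close>, so such a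
  divisor must also divide \<open>b\<close>.\<close>
lemma ud_in_Z_rational_linear:
  fixes r :: real
  assumes ud: "ud_in_Z (\<lambda>k. \<lfloor>c + r * real k\<rfloor>)" and "r \<in> \<rat>"
  shows "\<exists>l::int. l \<noteq> 0 \<and> r = 1 / of_int l"
proof -
  obtain a b :: int where b: "b > 0" "coprime a b" and r: "r = of_int a / of_int b"
    using \<open>r \<in> \<rat>\<close> by (rule Rats_cases')
  have "\<bar>a\<bar> = 1"
  proof (rule ccontr)
    assume "\<bar>a\<bar> \<noteq> 1"
    \<comment> \<open>Every integer divides \<open>a = 0\<close>, so there any modulus will do.\<close>
    define m where "m = (if a = 0 then 2 else \<bar>a\<bar>)"
    have m: "m \<ge> 2" "m dvd a"
      using \<open>\<bar>a\<bar> \<noteq> 1\<close> by (auto simp: m_def)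
    have "m dvd int (nat b)"
    proof (rule ud_mod_periodic_imp_dvd)
      show "ud_mod (\<lambda>k. \<lfloor>c + r * real k\<rfloor>) m" "m \<ge> 1"
        using ud m by (auto simp: ud_in_Z_def)
      fix k
      have "c + r * real (k + nat b) = c + r * real k + of_int a"
        using b by (simp add: r field_simps)
      then have "\<lfloor>c + r * real (k + nat b)\<rfloor> = \<lfloor>c + r * real k\<rfloor> + a"
        by (simp only: floor_add_int)
      then show "[\<lfloor>c + r * real (k + nat b)\<rfloor> = \<lfloor>c + r * real k\<rfloor>] (mod m)"
        using m by (simp add: cong_iff_dvd_diff)
    qed
    then have "m dvd b"
      using b by simp
    then have "is_unit m"
      using m b by (intro coprime_common_divisor[of a b m])
    then show False
      using m by simp
  qed
  then have "r = 1 / of_int (a * b)" "a * b \<noteq> 0"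
    using b by (auto simp: r abs_if split: if_splits)
  then show ?thesis by blast
qed

theorem theorem5:
  fixes P :: "real poly"
  shows "ud_in_Z (\<lambda>k. \<lfloor>poly P (real k)\<rfloor>) \<longleftrightarrow>
    (\<exists>i\<ge>1. coeff P i \<notin> \<rat>) \<or>
    (\<exists>l::int. l \<noteq> 0 \<and> P = [:poly P 0, 1 / real_of_int l:])"
proof
  assume ud: "ud_in_Z (\<lambda>k. \<lfloor>poly P (real k)\<rfloor>)"
  show "(\<exists>i\<ge>1. coeff P i \<notin> \<rat>) \<or>
    (\<exists>l::int. l \<noteq> 0 \<and> P = [:poly P 0, 1 / real_of_int l:])"
  proof (cases "\<exists>i\<ge>1. coeff P i \<notin> \<rat>")
    case False
    then have rat: "coeff P i \<in> \<rat>" if "i \<ge> 1" for i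
      using that by blast
    then have "degree P \<le> 1"
      using not_ud_in_Z_rational_nonlinear[of P] ud by force
    then have P: "P = [:poly P 0, coeff P 1:]"
      by (intro poly_eqI) (auto simp: coeff_pCons poly_0_coeff_0 coeff_eq_0 split: nat.split)
    have poly: "poly P (real k) = poly P 0 + coeff P 1 * real k" for k
      using arg_cong[OF P, of "\<lambda>p. poly p (real k)"] by (simp add: mult.commute)
    have "\<exists>l::int. l \<noteq> 0 \<and> coeff P 1 = 1 / of_int l"
      using ud rat[of 1] unfolding poly by (intro ud_in_Z_rational_linear[of "poly P 0"]) auto
    then show ?thesis
      using P by metis
  qed blast
next
  assume "(\<exists>i\<ge>1. coeff P i \<notin> \<rat>) \<or>
    (\<exists>l::int. l \<noteq> 0 \<and> P = [:poly P 0, 1 / real_of_int l:])"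
  then show "ud_in_Z (\<lambda>k. \<lfloor>poly P (real k)\<rfloor>)"
  proof (elim disjE exE conjE)
    fix l :: int assume l: "l \<noteq> 0" and P: "P = [:poly P 0, 1 / real_of_int l:]"
    have "poly P (real k) = poly P 0 + real k / of_int l" for k
      using arg_cong[OF P, of "\<lambda>p. poly p (real k)"] by simp
    then show ?thesis
      using ud_in_Z_slope_one_over_int[OF l, of "poly P 0"] by simp
  qed (rule ud_in_Z_irrational)
qed

end
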